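(* Let $X$ be a quandle with finitely many orbits and let $m=|\mathrm{Orb}(X)|$. Then there exists a short exact sequence $$0\to H_2^{\rm R}(X)\to H_3^{\rm D}(X)\to\mathbf{Z}^{m^2-m}\to0.$$
   Context: A quandle is a set $X$ with a binary operation $*$ such that $a*a=a$; for all $a,b$ there is a unique $c$ with $a=c*b$; and $(a*b)*c=(a*c)*(b*c)$. The maps $S(b):a\mapsto a*b$ are automorphisms of $X$ and generate the group of inner automorphisms; $\mathrm{Orb}(X)$ is the set of orbits of this group on $X$. For $n\ge1$, $C_n^{\rm R}(X)$ is the free abelian group on $n$-tuples $(x_1,\dots,x_n)\in X^n$, $C_n^{\rm R}(X)=0$ for $n\le0$; for $n\ge2$ $$\partial_n(x_1,\dots,x_n)=\sum_{i=2}^n(-1)^i\big[(x_1,\dots,x_{i-1},x_{i+1},\dots,x_n)-(x_1*x_i,\dots,x_{i-1}*x_i,x_{i+1},\dots,x_n)\big],$$ and $\partial_n=0$ for $n\le1$. $C_n^{\rm D}(X)\subset C_n^{\rm R}(X)$ is the subgroup generated by tuples with $x_i=x_{i+1}$ for some $i\in\{1,\dots,n-1\}$ (zero if $n\le1$); it is a subcomplex. $H_n^{\rm R}(X)=H_n(C_*^{\rm R}(X))$ and $H_n^{\rm D}(X)=H_n(C_*^{\rm D}(X))$. *)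

theory Defs
  imports
    "HOL-Algebra.Free_Abelian_Groups"
    "HOL-Algebra.Product_Groups"
    "HOL-Algebra.Group_Action"
    "HOL-Algebra.Bij"
begin

locale quandle =
  fixes Q :: "'a set" and opr :: "'a \<Rightarrow> 'a \<Rightarrow> 'a" (infixl \<open>\<triangleright>\<close> 70)
  assumes closed: "\<lbrakk>a \<in> Q; b \<in> Q\<rbrakk> \<Longrightarrow> a \<triangleright> b \<in> Q"
    and idem: "a \<in> Q \<Longrightarrow> a \<triangleright> a = a"
    and right_div: "\<lbrakk>a \<in> Q; b \<in> Q\<rbrakk> \<Longrightarrow> \<exists>!c. c \<in> Q \<and> a = c \<triangleright> b"
    and self_distrib:
      "\<lbrakk>a \<in> Q; b \<in> Q; c \<in> Q\<rbrakk> \<Longrightarrow> (a \<triangleright> b) \<triangleright> c = (a \<triangleright> c) \<triangleright> (b \<triangleright> c)"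

definition symmetry :: "'a set \<Rightarrow> ('a \<Rightarrow> 'a \<Rightarrow> 'a) \<Rightarrow> 'a \<Rightarrow> 'a \<Rightarrow> 'a" where
  "symmetry Q opr b = (\<lambda>a\<in>Q. opr a b)"

(* The symmetries are automorphisms, so the subgroup they generate in the group of all
   permutations of Q is the one they generate in the automorphism group. *)
definition inner_group :: "'a set \<Rightarrow> ('a \<Rightarrow> 'a \<Rightarrow> 'a) \<Rightarrow> ('a \<Rightarrow> 'a) monoid" where
  "inner_group Q opr = subgroup_generated (BijGroup Q) (symmetry Q opr ` Q)"

definition Orb :: "'a set \<Rightarrow> ('a \<Rightarrow> 'a \<Rightarrow> 'a) \<Rightarrow> 'a set set" where
  "Orb Q opr = orbits (inner_group Q opr) Q (\<lambda>g. g)"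

(* n-tuples are lists of length n; there are no generators in degrees n < 1. *)
definition tuples :: "'a set \<Rightarrow> int \<Rightarrow> 'a list set" where
  "tuples Q n = {xs. 1 \<le> n \<and> int (length xs) = n \<and> set xs \<subseteq> Q}"

definition rack_chain :: "'a set \<Rightarrow> int \<Rightarrow> ('a list \<Rightarrow>\<^sub>0 int) monoid" where
  "rack_chain Q n = free_Abelian_group (tuples Q n)"

(* The index i is 1-based: x_i is "xs ! (i - 1)".  The sum is empty for tuples of length 1. *)
definition boundary_tuple :: "('a \<Rightarrow> 'a \<Rightarrow> 'a) \<Rightarrow> 'a list \<Rightarrow> ('a list \<Rightarrow>\<^sub>0 int)" where
  "boundary_tuple opr xs =
     (\<Sum>i\<in>{2..length xs}. frag_cmul ((-1) ^ i)
        (frag_of (take (i - 1) xs @ drop i xs)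
         - frag_of (map (\<lambda>x. opr x (xs ! (i - 1))) (take (i - 1) xs) @ drop i xs)))"

definition boundary ::
  "('a \<Rightarrow> 'a \<Rightarrow> 'a) \<Rightarrow> ('a list \<Rightarrow>\<^sub>0 int) \<Rightarrow> ('a list \<Rightarrow>\<^sub>0 int)" where
  "boundary opr = frag_extend (boundary_tuple opr)"

definition degenerate_tuples :: "'a set \<Rightarrow> int \<Rightarrow> 'a list set" where
  "degenerate_tuples Q n =
     {xs \<in> tuples Q n. \<exists>i. Suc i < length xs \<and> xs ! i = xs ! Suc i}"

definition degenerate_chain :: "'a set \<Rightarrow> int \<Rightarrow> ('a list \<Rightarrow>\<^sub>0 int) monoid" where
  "degenerate_chain Q n =
     subgroup_generated (rack_chain Q n) (frag_of ` degenerate_tuples Q n)"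

(* Homology of a chain complex C whose differentials C n -> C (n - 1) are all given by d. *)
definition homology_of :: "(int \<Rightarrow> 'b monoid) \<Rightarrow> ('b \<Rightarrow> 'b) \<Rightarrow> int \<Rightarrow> 'b set monoid" where
  "homology_of C d n =
     subgroup_generated (C n) (kernel (C n) (C (n - 1)) d) Mod (d ` carrier (C (n + 1)))"

definition rack_homology ::
  "'a set \<Rightarrow> ('a \<Rightarrow> 'a \<Rightarrow> 'a) \<Rightarrow> int \<Rightarrow> ('a list \<Rightarrow>\<^sub>0 int) set monoid" where
  "rack_homology Q opr = homology_of (rack_chain Q) (boundary opr)"

definition degenerate_homology ::
  "'a set \<Rightarrow> ('a \<Rightarrow> 'a \<Rightarrow> 'a) \<Rightarrow> int \<Rightarrow> ('a list \<Rightarrow>\<^sub>0 int) set monoid" where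
  "degenerate_homology Q opr = homology_of (degenerate_chain Q) (boundary opr)"

definition Z_power :: "nat \<Rightarrow> (nat \<Rightarrow> int) monoid" where
  "Z_power k = product_group {..<k} (\<lambda>_. integer_group)"

(* 0 -> A -f-> B -g-> C -> 0.  The library's short_exact_sequence requires the three groups
   to have the same element type. *)
definition short_exact ::
  "'a monoid \<Rightarrow> 'b monoid \<Rightarrow> 'c monoid \<Rightarrow> ('a \<Rightarrow> 'b) \<Rightarrow> ('b \<Rightarrow> 'c) \<Rightarrow> bool" where
  "short_exact A B C f g \<longleftrightarrow>
     group A \<and> group B \<and> group C \<and>
     f \<in> mon A B \<and> g \<in> epi B C \<and> f ` carrier A = kernel B C g"

end

(* Doubling the first entry, (x, y, ...) |-> (x, x, y, ...), anticommutes with the boundary and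
   embeds C^R_* into C^D_{*+1}.  It is split injective on homology in degree 2: (x, x, y) |-> (x, y),
   extended by (x, y, y) |-> (y, y) if x and y share an orbit and by 0 otherwise, is a left inverse
   taking boundaries to boundaries.  Modulo the image, C^D_3 is spanned by the tuples (x, y, y) with
   x, y distinct, all of which are cycles, and the boundaries of (x, y, y, w) and (x, w, y, y)
   identify such tuples exactly when the orbits of x and of y agree.  A tuple with x and y in
   one orbit is homologous to (y, y, y), which lies in the image; what remains is free on the
   ordered pairs of distinct orbits. *)

theory Submission
  imports Defs
begin

section \<open>Short exact sequences of quotients\<close>

lemma (in group) r_coset_eq_iff:
  assumes H: "subgroup H G" and "x \<in> carrier G" "y \<in> carrier G"
  shows "H #> x = H #> y \<longleftrightarrow> x \<otimes> inv y \<in> H"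
  using assms subgroup.rcos_module[OF H is_group, of y x] repr_independence[OF _ _ H, of x y]
    rcos_self[OF _ H, of x] by auto

text \<open>All hypotheses concern representatives. The two directions of \<open>fMN\<close> make
  the map induced by \<open>f\<close> well defined and injective, \<open>gN\<close> lets
  \<open>g\<close> descend, and \<open>gf\<close> with \<open>ker\<close> gives exactness in the
  middle.\<close>

lemma short_exact_FactGroup:
  assumes A: "comm_group A" and B: "comm_group B" and C: "group C"
    and M: "subgroup M A" and N: "subgroup N B"
    and f: "f \<in> hom A B" and g: "g \<in> epi B C"
    and fMN: "\<And>a. a \<in> carrier A \<Longrightarrow> f a \<in> N \<longleftrightarrow> a \<in> M"
    and gN: "\<And>b. b \<in> N \<Longrightarrow> g b = \<one>\<^bsub>C\<^esub>"
    and gf: "\<And>a. a \<in> carrier A \<Longrightarrow> g (f a) = \<one>\<^bsub>C\<^esub>"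
    and ker: "\<And>b. \<lbrakk>b \<in> carrier B; g b = \<one>\<^bsub>C\<^esub>\<rbrakk> \<Longrightarrow> \<exists>n\<in>N. \<exists>a\<in>carrier A. b = n \<otimes>\<^bsub>B\<^esub> f a"
  shows "\<exists>f' g'. short_exact (A Mod M) (B Mod N) C f' g'"
proof -
  interpret A: comm_group A by fact
  interpret B: comm_group B by fact
  interpret C: group C by fact
  interpret M: normal M A by (rule A.subgroup_imp_normal[OF M])
  interpret N: normal N B by (rule B.subgroup_imp_normal[OF N])
  interpret f: group_hom A B f by unfold_locales (rule f)
  have g_hom: "g \<in> hom B C" and g_onto: "g ` carrier B = carrier C"
    using g by (auto simp: epi_def)
  interpret g: group_hom B C g by unfold_locales (rule g_hom)
  have f_coset: "N #>\<^bsub>B\<^esub> f x = N #>\<^bsub>B\<^esub> f y \<longleftrightarrow> M #>\<^bsub>A\<^esub> x = M #>\<^bsub>A\<^esub> y"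
    if "x \<in> carrier A" "y \<in> carrier A" for x y
    using that fMN[of "x \<otimes>\<^bsub>A\<^esub> inv\<^bsub>A\<^esub> y"] by (simp add: A.r_coset_eq_iff B.r_coset_eq_iff M N)
  have "(\<lambda>a. N #>\<^bsub>B\<^esub> f a) \<in> hom A (B Mod N)"
    using hom_compose[OF f N.r_coset_hom_Mod] by (simp add: o_def)
  from FactGroup_universal[OF this M.normal_axioms] f_coset
  obtain f' where f': "f' \<in> hom (A Mod M) (B Mod N)"
    "\<And>x. x \<in> carrier A \<Longrightarrow> f' (M #>\<^bsub>A\<^esub> x) = N #>\<^bsub>B\<^esub> f x"
    by blast
  have g_coset: "g x = g y" if "x \<in> carrier B" "y \<in> carrier B" "N #>\<^bsub>B\<^esub> x = N #>\<^bsub>B\<^esub> y" for x y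
  proof -
    have "g x \<otimes>\<^bsub>C\<^esub> inv\<^bsub>C\<^esub> g y = \<one>\<^bsub>C\<^esub>"
      using gN[of "x \<otimes>\<^bsub>B\<^esub> inv\<^bsub>B\<^esub> y"] that by (simp add: B.r_coset_eq_iff N)
    then show ?thesis
      using that by (metis C.inv_closed C.inv_equality C.inv_inv g.hom_closed)
  qed
  from FactGroup_universal[OF g_hom N.normal_axioms this]
  obtain g' where g': "g' \<in> hom (B Mod N) C"
    "\<And>x. x \<in> carrier B \<Longrightarrow> g' (N #>\<^bsub>B\<^esub> x) = g x"
    by blast
  have "f' \<in> mon (A Mod M) (B Mod N)"
    using f' f_coset by (auto simp: mon_def carrier_FactGroup inj_on_def)
  moreover have "g' \<in> epi (B Mod N) C"
    using g' g_onto by (force simp: epi_def carrier_FactGroup image_image)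
  moreover have "f' ` carrier (A Mod M) = kernel (B Mod N) C g'"
  proof (intro equalityI subsetI)
    fix X assume "X \<in> f' ` carrier (A Mod M)"
    then show "X \<in> kernel (B Mod N) C g'"
      using f' g' gf by (auto simp: kernel_def carrier_FactGroup)
  next
    fix X assume "X \<in> kernel (B Mod N) C g'"
    then obtain b where b: "b \<in> carrier B" "X = N #>\<^bsub>B\<^esub> b" "g b = \<one>\<^bsub>C\<^esub>"
      using g' by (auto simp: kernel_def carrier_FactGroup)
    then obtain n a where na: "n \<in> N" "a \<in> carrier A" "b = n \<otimes>\<^bsub>B\<^esub> f a"
      using ker by blast
    then have "X = N #>\<^bsub>B\<^esub> f a"
      using b by (simp add: B.r_coset_eq_iff N B.m_assoc)
    then show "X \<in> f' ` carrier (A Mod M)"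
      using na f' by (auto simp: carrier_FactGroup)
  qed
  ultimately show ?thesis
    using M.factorgroup_is_group N.factorgroup_is_group C unfolding short_exact_def by blast
qed

section \<open>Complexes of free abelian groups\<close>

text \<open>Brings \<open>degenerate_chain\<close> into the same form as \<open>rack_chain\<close>,
  so that one treatment of free groups serves both complexes.\<close>

lemma subgroup_generated_frag_of:
  assumes "T \<subseteq> S"
  shows "subgroup_generated (free_Abelian_group S) (frag_of ` T) = free_Abelian_group T"
proof -
  let ?F = "free_Abelian_group S"
  interpret F: group ?F by simp
  have sub: "subgroup (carrier (free_Abelian_group T)) ?F"
    using assms by (auto simp: subgroup_def dest: subsetD[OF keys_add])
  have gen: "subgroup (carrier (subgroup_generated ?F (frag_of ` T))) ?F"
    by (rule F.subgroup_subgroup_generated)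
  have "carrier (subgroup_generated ?F (frag_of ` T)) = carrier (free_Abelian_group T)"
  proof
    show "carrier (subgroup_generated ?F (frag_of ` T)) \<subseteq> carrier (free_Abelian_group T)"
      by (rule F.subgroup_generated_minimal[OF sub]) auto
    show "carrier (free_Abelian_group T) \<subseteq> carrier (subgroup_generated ?F (frag_of ` T))"
    proof
      fix c assume "c \<in> carrier (free_Abelian_group T)"
      then have "Poly_Mapping.keys c \<subseteq> T" by simp
      then show "c \<in> carrier (subgroup_generated ?F (frag_of ` T))"
      proof (induction c rule: free_Abelian_group_induct[consumes 1])
        case 1
        then show ?case using subgroup.one_closed[OF gen] by simp
      next
        case (2 x y)
        then have "x \<otimes>\<^bsub>?F\<^esub> inv\<^bsub>?F\<^esub> y \<in> carrier (subgroup_generated ?F (frag_of ` T))"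
          by (intro subgroup.m_closed[OF gen] subgroup.m_inv_closed[OF gen])
        then show ?case using 2 assms by (simp add: order_trans[of _ T S])
      next
        case (3 a)
        then show ?case
          using assms
          by (intro subsetD[OF F.subgroup_generated_subset_carrier_subset[of "frag_of ` T"]]) auto
      qed
    qed
  qed
  \<comment> \<open>Both monoids carry the addition and zero of finitely supported functions, so
    equal carriers make them equal.\<close>
  then show ?thesis
    by (simp add: subgroup_generated_def free_Abelian_group_def)
qed

text \<open>All chain groups share the same zero, so the kernel is written as \<open>= 0\<close>
  without naming a target group; \<open>d\<close> gives the differential on generators.\<close>

definition cycles where
  "cycles S d = {c. Poly_Mapping.keys c \<subseteq> S \<and> frag_extend d c = 0}"

definition boundaries where
  "boundaries S d = frag_extend d ` {c. Poly_Mapping.keys c \<subseteq> S}"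

lemma subgroup_cycles: "subgroup (cycles S d) (free_Abelian_group S)"
  by (auto simp: subgroup_def cycles_def frag_extend_add frag_extend_minus
      dest: subsetD[OF keys_add])

lemma boundaries_diff:
  assumes "x \<in> boundaries S d" and "y \<in> boundaries S d"
  shows "x - y \<in> boundaries S d"
proof -
  from assms obtain u v where "Poly_Mapping.keys u \<subseteq> S" "Poly_Mapping.keys v \<subseteq> S"
    "x = frag_extend d u" "y = frag_extend d v"
    by (auto simp: boundaries_def)
  moreover from this have "Poly_Mapping.keys (u - v) \<subseteq> S"
    using keys_diff[of u v] by auto
  ultimately show ?thesis
    unfolding boundaries_def by (intro image_eqI[of _ _ "u - v"]) (simp_all add: frag_extend_diff)
qed

lemma zero_in_boundaries: "0 \<in> boundaries S d"
  unfolding boundaries_def by (rule image_eqI[of _ _ 0]) auto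

lemma boundaries_minus: "x \<in> boundaries S d \<Longrightarrow> - x \<in> boundaries S d"
  using boundaries_diff[OF zero_in_boundaries, of x S d] by simp

lemma boundaries_add:
  "\<lbrakk>x \<in> boundaries S d; y \<in> boundaries S d\<rbrakk> \<Longrightarrow> x + y \<in> boundaries S d"
  using boundaries_diff[OF _ boundaries_minus, of x S d y] by simp

lemma boundaries_generator: "a \<in> S \<Longrightarrow> d a \<in> boundaries S d"
  unfolding boundaries_def by (rule image_eqI[of _ _ "frag_of a"]) auto

text \<open>Lets a claim about all boundaries be checked on boundaries of single tuples, as long as
  it survives differences.\<close>

lemma boundaries_induct [consumes 1, case_names zero diff gen]:
  assumes "x \<in> boundaries S d" and "P 0"
    and "\<And>x y. \<lbrakk>P x; P y\<rbrakk> \<Longrightarrow> P (x - y)" and "\<And>a. a \<in> S \<Longrightarrow> P (d a)"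
  shows "P x"
proof -
  obtain c where "Poly_Mapping.keys c \<subseteq> S" and x: "x = frag_extend d c"
    using assms(1) by (auto simp: boundaries_def)
  from this(1) have "P (frag_extend d c)"
  proof (induction c rule: free_Abelian_group_induct[consumes 1])
  qed (simp_all add: assms frag_extend_diff)
  then show ?thesis by (simp add: x)
qed

lemma homology_of_free_Abelian_group:
  assumes "\<And>k. C k = free_Abelian_group (S k)"
  shows "homology_of C (frag_extend d) n =
    subgroup_generated (free_Abelian_group (S n)) (cycles (S n) d) Mod boundaries (S (n + 1)) d"
proof -
  have "kernel (C n) (C (n - 1)) (frag_extend d) = cycles (S n) d"
    by (auto simp: kernel_def assms cycles_def)
  moreover have "frag_extend d ` carrier (C (n + 1)) = boundaries (S (n + 1)) d"
    by (simp add: boundaries_def assms free_Abelian_group_def)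
  ultimately show ?thesis
    by (simp add: homology_of_def assms)
qed

lemma subgroup_boundaries:
  assumes "boundaries S d \<subseteq> cycles T d'"
  shows "subgroup (boundaries S d) (subgroup_generated (free_Abelian_group T) (cycles T d'))"
proof (rule group.subgroup_of_subgroup_generated[OF _ assms])
  show "subgroup (boundaries S d) (free_Abelian_group T)"
    using assms
    by (auto simp: subgroup_def cycles_def zero_in_boundaries boundaries_add boundaries_minus)
qed simp

lemma carrier_cycle_group [simp]:
  "carrier (subgroup_generated (free_Abelian_group S) (cycles S d)) = cycles S d"
  by (rule subgroup.carrier_subgroup_generated_subgroup[OF subgroup_cycles])

lemma comm_group_cycle_group:
  "comm_group (subgroup_generated (free_Abelian_group S) (cycles S d))"
  by (simp add: group.abelian_subgroup_generated abelian_free_Abelian_group)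

text \<open>The quotient criterion restated for chains. The degrees \<open>n\<close> and
  \<open>k\<close> are independent because the intended \<open>f\<close> raises the degree.
  \<open>BC\<close> and \<open>BD\<close> say that the differential squares to zero;
  \<open>f_boundaries\<close> yields injectivity on homology.\<close>

lemma short_exact_homology:
  fixes d :: "'a \<Rightarrow> 'a \<Rightarrow>\<^sub>0 int" and e :: "'b \<Rightarrow> 'b \<Rightarrow>\<^sub>0 int"
  assumes C: "\<And>k. C k = free_Abelian_group (S k)" and D: "\<And>k. D k = free_Abelian_group (T k)"
    and BC: "boundaries (S (n + 1)) d \<subseteq> cycles (S n) d"
    and BD: "boundaries (T (k + 1)) e \<subseteq> cycles (T k) e"
    and K: "group K"
    and f_cycles: "\<And>c. c \<in> cycles (S n) d \<Longrightarrow> f c \<in> cycles (T k) e"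
    and f_add: "\<And>x y. f (x + y) = f x + f y"
    and f_boundaries:
      "\<And>c. c \<in> cycles (S n) d \<Longrightarrow> f c \<in> boundaries (T (k + 1)) e \<longleftrightarrow> c \<in> boundaries (S (n + 1)) d"
    and g_add: "\<And>x y. g (x + y) = g x \<otimes>\<^bsub>K\<^esub> g y"
    and g_onto: "g ` cycles (T k) e = carrier K"
    and g_boundaries: "\<And>c. c \<in> boundaries (T (k + 1)) e \<Longrightarrow> g c = \<one>\<^bsub>K\<^esub>"
    and gf: "\<And>c. c \<in> cycles (S n) d \<Longrightarrow> g (f c) = \<one>\<^bsub>K\<^esub>"
    and ker: "\<And>c. \<lbrakk>c \<in> cycles (T k) e; g c = \<one>\<^bsub>K\<^esub>\<rbrakk>
      \<Longrightarrow> \<exists>a\<in>cycles (S n) d. c - f a \<in> boundaries (T (k + 1)) e"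
  shows "\<exists>f' g'. short_exact (homology_of C (frag_extend d) n)
                   (homology_of D (frag_extend e) k) K f' g'"
proof -
  let ?A = "subgroup_generated (free_Abelian_group (S n)) (cycles (S n) d)"
  let ?B = "subgroup_generated (free_Abelian_group (T k)) (cycles (T k) e)"
  have f: "f \<in> hom ?A ?B"
    using f_cycles f_add by (simp add: hom_def)
  have g: "g \<in> epi ?B K"
    using g_add g_onto by (auto simp: epi_def hom_def)
  have "\<exists>b\<in>boundaries (T (k + 1)) e. \<exists>a\<in>carrier ?A. c = b \<otimes>\<^bsub>?B\<^esub> f a"
    if c: "c \<in> carrier ?B" "g c = \<one>\<^bsub>K\<^esub>" for c
  proof -
    obtain a where "a \<in> cycles (S n) d" "c - f a \<in> boundaries (T (k + 1)) e"
      using ker c by auto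
    then show ?thesis
      by (intro bexI[of _ "c - f a"] bexI[of _ a]) auto
  qed
  then have "\<exists>f' g'. short_exact (?A Mod boundaries (S (n + 1)) d)
      (?B Mod boundaries (T (k + 1)) e) K f' g'"
    by (intro short_exact_FactGroup[OF comm_group_cycle_group comm_group_cycle_group K
          subgroup_boundaries[OF BC] subgroup_boundaries[OF BD] f g])
      (simp_all add: f_boundaries g_boundaries gf)
  then show ?thesis
    by (simp only: homology_of_free_Abelian_group[of C S, OF C]
        homology_of_free_Abelian_group[of D T, OF D])
qed

section \<open>Rack and degenerate chains in low degrees\<close>

lemma tuples_2: "xs \<in> tuples Q 2 \<longleftrightarrow> (\<exists>x\<in>Q. \<exists>y\<in>Q. xs = [x, y])"
proof
  assume "xs \<in> tuples Q 2"
  then have "length xs = Suc (Suc 0)" "set xs \<subseteq> Q" by (auto simp: tuples_def)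
  then show "\<exists>x\<in>Q. \<exists>y\<in>Q. xs = [x, y]" by (auto simp: length_Suc_conv)
qed (auto simp: tuples_def)

lemma tuples_3: "xs \<in> tuples Q 3 \<longleftrightarrow> (\<exists>x\<in>Q. \<exists>y\<in>Q. \<exists>z\<in>Q. xs = [x, y, z])"
proof
  assume "xs \<in> tuples Q 3"
  then have "length xs = Suc (Suc (Suc 0))" "set xs \<subseteq> Q" by (auto simp: tuples_def)
  then show "\<exists>x\<in>Q. \<exists>y\<in>Q. \<exists>z\<in>Q. xs = [x, y, z]" by (auto simp: length_Suc_conv)
qed (auto simp: tuples_def)

lemma tuples_4:
  "xs \<in> tuples Q 4 \<longleftrightarrow> (\<exists>x\<in>Q. \<exists>y\<in>Q. \<exists>z\<in>Q. \<exists>w\<in>Q. xs = [x, y, z, w])"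
proof
  assume "xs \<in> tuples Q 4"
  then have "length xs = Suc (Suc (Suc (Suc 0)))" "set xs \<subseteq> Q" by (auto simp: tuples_def)
  then show "\<exists>x\<in>Q. \<exists>y\<in>Q. \<exists>z\<in>Q. \<exists>w\<in>Q. xs = [x, y, z, w]"
    by (auto simp: length_Suc_conv)
qed (auto simp: tuples_def)

lemma degenerate_tuples_3:
  "xs \<in> degenerate_tuples Q 3 \<longleftrightarrow> 
    (\<exists>x\<in>Q. \<exists>y\<in>Q. xs = [x, x, y]) \<or> (\<exists>x\<in>Q. \<exists>y\<in>Q. xs = [x, y, y])"
  by (auto simp: degenerate_tuples_def tuples_3 less_Suc_eq)

lemma degenerate_tuples_4:
  "xs \<in> degenerate_tuples Q 4 \<longleftrightarrow>
    (\<exists>x\<in>Q. \<exists>y\<in>Q. \<exists>z\<in>Q. xs = [x, x, y, z]) \<or>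
    (\<exists>x\<in>Q. \<exists>y\<in>Q. \<exists>z\<in>Q. xs = [x, y, y, z]) \<or>
    (\<exists>x\<in>Q. \<exists>y\<in>Q. \<exists>z\<in>Q. xs = [x, y, z, z])"
  by (auto simp: degenerate_tuples_def tuples_4 less_Suc_eq)

lemma boundary_tuple_2:
  "boundary_tuple opr [x, y] = frag_of [x] - frag_of [opr x y]"
  by (simp add: boundary_tuple_def)

lemma boundary_tuple_3:
  "boundary_tuple opr [x, y, z] =
    (frag_of [x, z] - frag_of [opr x y, z]) - (frag_of [x, y] - frag_of [opr x z, opr y z])"
proof -
  have "{2..3} = {2, 3::nat}" by auto
  then show ?thesis by (simp add: boundary_tuple_def)
qed

lemma boundary_tuple_4:
  "boundary_tuple opr [x, y, z, w] =
    (frag_of [x, z, w] - frag_of [opr x y, z, w])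
    - (frag_of [x, y, w] - frag_of [opr x z, opr y z, w])
    + (frag_of [x, y, z] - frag_of [opr x w, opr y w, opr z w])"
proof -
  have "{2..4} = {2, 3, 4::nat}" by auto
  then show ?thesis by (simp add: boundary_tuple_def numeral_eq_Suc)
qed

context quandle
begin

section \<open>Orbits of the inner automorphism group\<close>

definition orbit_of :: "'a \<Rightarrow> 'a set" where
  "orbit_of = orbit (inner_group Q (\<triangleright>)) (\<lambda>g. g)"

text \<open>Uniqueness in \<open>right_div\<close> is injectivity, existence is
  surjectivity.\<close>

lemma symmetry_in_Bij:
  assumes "b \<in> Q" shows "symmetry Q (\<triangleright>) b \<in> Bij Q"
proof -
  have "bij_betw (\<lambda>a. a \<triangleright> b) Q Q"
    unfolding bij_betw_def
  proof
    show "inj_on (\<lambda>a. a \<triangleright> b) Q"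
      using right_div[OF closed assms] assms by (auto simp: inj_on_def)
    show "(\<lambda>a. a \<triangleright> b) ` Q = Q"
      using right_div[OF _ assms] closed assms by blast
  qed
  then show ?thesis
    by (simp add: Bij_def symmetry_def cong: bij_betw_cong)
qed

text \<open>\<open>subgroup_generated\<close> intersects its generators with the carrier; here the
  intersection changes nothing, as the symmetries are permutations.\<close>

lemma carrier_inner_group:
  "carrier (inner_group Q (\<triangleright>)) = generate (BijGroup Q) (symmetry Q (\<triangleright>) ` Q)"
proof -
  have "symmetry Q (\<triangleright>) ` Q \<subseteq> carrier (BijGroup Q)"
    by (auto simp: BijGroup_def symmetry_in_Bij)
  then show ?thesis
    by (simp add: inner_group_def carrier_subgroup_generated Int_absorb1)
qed

sublocale inner: group_action "inner_group Q (\<triangleright>)" Q "\<lambda>g. g"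
proof (rule group_action.intro)
  interpret group "BijGroup Q" by (rule group_BijGroup)
  have "carrier (inner_group Q (\<triangleright>)) \<subseteq> carrier (BijGroup Q)"
    unfolding inner_group_def by (rule carrier_subgroup_generated_subset)
  then show "group_hom (inner_group Q (\<triangleright>)) (BijGroup Q) (\<lambda>g. g)"
    by (auto simp: group_hom_def group_hom_axioms_def hom_def inner_group_def group_BijGroup)
qed

lemma orbit_of_eq_iff:
  assumes "x \<in> Q" "y \<in> Q"
  shows "orbit_of x = orbit_of y \<longleftrightarrow> y \<in> orbit_of x"
proof
  show "y \<in> orbit_of x" if "orbit_of x = orbit_of y"
    using that inner.orbit_refl assms by (auto simp: orbit_of_def)
  assume y: "y \<in> orbit_of x"
  have in_Q: "z \<in> Q" if "u \<in> Q" "z \<in> orbit_of u" for u z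
    using that inner.element_image by (auto simp: orbit_of_def orbit_def)
  have x: "x \<in> orbit_of y"
    using y assms inner.orbit_sym by (simp add: orbit_of_def)
  show "orbit_of x = orbit_of y"
    using x y assms in_Q inner.orbit_trans unfolding orbit_of_def by blast
qed

text \<open>As a simp rule, this makes the orbit tests in \<open>retract\<close> and
  \<open>orbit_class\<close> give the same answer on both terms of a difference in the boundary
  formula.\<close>

lemma orbit_of_opr [simp]:
  assumes "x \<in> Q" "b \<in> Q"
  shows "orbit_of (x \<triangleright> b) = orbit_of x"
proof -
  have "symmetry Q (\<triangleright>) b \<in> carrier (inner_group Q (\<triangleright>))"
    using assms by (auto simp: carrier_inner_group intro: generate.incl)
  then have "x \<triangleright> b \<in> orbit_of x"
    unfolding orbit_of_def orbit_def using assms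
    by (auto simp: symmetry_def intro!: exI[of _ "symmetry Q (\<triangleright>) b"])
  then show ?thesis
    using orbit_of_eq_iff[of x "x \<triangleright> b"] assms closed by simp
qed

text \<open>A property respected by each symmetry is respected by the group they generate. The
  hypothesis is an equivalence so that it passes to inverses.\<close>

lemma orbit_of_invariant:
  assumes x: "x \<in> Q" and y: "y \<in> Q" and orb: "orbit_of x = orbit_of y"
    and P: "\<And>z b. \<lbrakk>z \<in> Q; b \<in> Q\<rbrakk> \<Longrightarrow> P (z \<triangleright> b) \<longleftrightarrow> P z"
  shows "P x \<longleftrightarrow> P y"
proof -
  \<comment> \<open>Membership in \<open>Bij Q\<close> is carried along because inverses and
    products in \<open>BijGroup Q\<close> unfold only for its elements.\<close>
  have "g \<in> Bij Q \<and> (\<forall>z\<in>Q. P (g z) \<longleftrightarrow> P z)"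
    if "g \<in> generate (BijGroup Q) (symmetry Q (\<triangleright>) ` Q)" for g
    using that
  proof induction
    case one
    then show ?case using id_Bij[of Q] by (simp add: BijGroup_def restrict_def)
  next
    case (incl h)
    then show ?case using P symmetry_in_Bij by (auto simp: symmetry_def)
  next
    case (inv h)
    then obtain b where b: "b \<in> Q" "h = symmetry Q (\<triangleright>) b" by auto
    then have h: "h \<in> Bij Q" and Ph: "\<And>z. z \<in> Q \<Longrightarrow> P (h z) \<longleftrightarrow> P z"
      using P symmetry_in_Bij by (auto simp: symmetry_def)
    have "P (inv_into Q h z) \<longleftrightarrow> P z" if "z \<in> Q" for z
      using Ph[of "inv_into Q h z"] Bij_inv_into_mem[OF h that] that h
      by (auto simp: Bij_def bij_betw_def f_inv_into_f)
    then show ?case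
      using h restrict_inv_into_Bij[OF h] by (simp add: inv_BijGroup restrict_def)
  next
    case (eng h1 h2)
    moreover from this have "h2 z \<in> Q" if "z \<in> Q" for z
      using Bij_imp_funcset that by blast
    ultimately show ?case
      by (simp add: BijGroup_def compose_Bij compose_eq)
  qed
  moreover have "y \<in> orbit_of x"
    using orb orbit_of_eq_iff x y by simp
  ultimately show ?thesis
    using x by (auto simp: orbit_of_def orbit_def carrier_inner_group)
qed

text \<open>The number is the degree in which the chains lie, one below that of the tuples bounding
  them. Degree 2 always means rack chains, degree 3 degenerate chains.\<close>

abbreviation "B2 \<equiv> boundaries (tuples Q 3) (boundary_tuple (\<triangleright>))"
abbreviation "B3 \<equiv> boundaries (degenerate_tuples Q 4) (boundary_tuple (\<triangleright>))"
abbreviation "Z2 \<equiv> cycles (tuples Q 2) (boundary_tuple (\<triangleright>))"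
abbreviation "Z3 \<equiv> cycles (degenerate_tuples Q 3) (boundary_tuple (\<triangleright>))"

section \<open>Boundaries are cycles in the two degrees used\<close>

lemma B2_subset_Z2: "B2 \<subseteq> Z2"
proof
  fix c assume "c \<in> B2"
  then show "c \<in> Z2"
  proof (induction rule: boundaries_induct)
    case (diff x y)
    then show ?case
      by (auto simp: cycles_def frag_extend_diff dest: subsetD[OF keys_diff])
  next
    case (gen a)
    then obtain x y z where "a = [x, y, z]" and Q: "x \<in> Q" "y \<in> Q" "z \<in> Q"
      by (auto simp: tuples_3)
    moreover have "Poly_Mapping.keys (boundary_tuple (\<triangleright>) [x, y, z]) \<subseteq> tuples Q 2"
      unfolding boundary_tuple_3
      using Q closed by (intro order_trans[OF keys_diff] Un_least) (auto simp: tuples_2)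
    moreover have "frag_extend (boundary_tuple (\<triangleright>)) (boundary_tuple (\<triangleright>) [x, y, z]) = 0"
      using Q by (simp add: boundary_tuple_3 boundary_tuple_2 frag_extend_diff self_distrib)
    ultimately show ?case by (simp add: cycles_def)
  qed (simp add: cycles_def)
qed

text \<open>The boundary must also stay degenerate. Terms breaking up the doubled pair cancel by
  \<open>idem\<close>: within the difference for i = 2 if the pair comes first, between two
  consecutive differences otherwise.\<close>

lemma B3_subset_Z3: "B3 \<subseteq> Z3"
proof
  fix c assume "c \<in> B3"
  then show "c \<in> Z3"
  proof (induction rule: boundaries_induct)
    case (diff x y)
    then show ?case
      by (auto simp: cycles_def frag_extend_diff dest: subsetD[OF keys_diff])
  next
    case (gen a)
    then obtain x y z where a: "a = [x, x, y, z] \<or> a = [x, y, y, z] \<or> a = [x, y, z, z]"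
      and Q: "x \<in> Q" "y \<in> Q" "z \<in> Q"
      by (auto simp: degenerate_tuples_4)
    have "Poly_Mapping.keys (boundary_tuple (\<triangleright>) a) \<subseteq> degenerate_tuples Q 3"
      using a Q closed
      by (auto simp: boundary_tuple_4 degenerate_tuples_3 idem
          dest!: subsetD[OF keys_diff] subsetD[OF keys_add])
    moreover have "frag_extend (boundary_tuple (\<triangleright>)) (boundary_tuple (\<triangleright>) a) = 0"
      using a Q
      by (auto simp: boundary_tuple_4 boundary_tuple_3 frag_extend_diff frag_extend_add
          self_distrib[symmetric] idem closed)
    ultimately show ?case by (simp add: cycles_def)
  qed (simp add: cycles_def)
qed

section \<open>Maps between rack chains, degenerate chains and orbit pairs\<close>

definition stutter :: "('a list \<Rightarrow>\<^sub>0 int) \<Rightarrow> ('a list \<Rightarrow>\<^sub>0 int)" where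
  "stutter = frag_extend (\<lambda>xs. frag_of (hd xs # xs))"

text \<open>One test covers both kinds of degenerate triple: [x, x, y] always passes it, and
  [x, y, y] passes when x and y share an orbit.\<close>

definition retract :: "('a list \<Rightarrow>\<^sub>0 int) \<Rightarrow> ('a list \<Rightarrow>\<^sub>0 int)" where
  "retract = frag_extend (\<lambda>xs.
     if orbit_of (xs ! 0) = orbit_of (xs ! 1) then frag_of (tl xs) else 0)"

text \<open>Complementary to \<open>retract\<close>: the same test with the vanishing branch
  exchanged, so each generator is seen by exactly one of the two maps.\<close>

definition orbit_class :: "('a list \<Rightarrow>\<^sub>0 int) \<Rightarrow> ('a set \<times> 'a set \<Rightarrow>\<^sub>0 int)" where
  "orbit_class = frag_extend (\<lambda>xs.
     if orbit_of (xs ! 0) = orbit_of (xs ! 1) then 0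
     else frag_of (orbit_of (xs ! 0), orbit_of (xs ! 1)))"

definition orbit_pairs :: "('a set \<times> 'a set) set" where
  "orbit_pairs = {(p, q). p \<in> Orb Q (\<triangleright>) \<and> q \<in> Orb Q (\<triangleright>) \<and> p \<noteq> q}"

definition orbit_rep :: "'a set \<Rightarrow> 'a" where
  "orbit_rep p = (SOME x. x \<in> Q \<and> orbit_of x = p)"

text \<open>A section of \<open>orbit_class\<close> on chains supported in
  \<open>orbit_pairs\<close>.\<close>

definition class_rep :: "('a set \<times> 'a set \<Rightarrow>\<^sub>0 int) \<Rightarrow> ('a list \<Rightarrow>\<^sub>0 int)" where
  "class_rep = frag_extend (\<lambda>(p, q). frag_of [orbit_rep p, orbit_rep q, orbit_rep q])"

lemma orbit_rep:
  assumes "p \<in> Orb Q (\<triangleright>)"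
  shows "orbit_rep p \<in> Q" and "orbit_of (orbit_rep p) = p"
proof -
  have "\<exists>x. x \<in> Q \<and> orbit_of x = p"
    using assms by (auto simp: Orb_def orbits_def orbit_of_def)
  then have "orbit_rep p \<in> Q \<and> orbit_of (orbit_rep p) = p"
    unfolding orbit_rep_def by (rule someI_ex)
  then show "orbit_rep p \<in> Q" and "orbit_of (orbit_rep p) = p" by auto
qed

lemma orbit_of_in_Orb: "x \<in> Q \<Longrightarrow> orbit_of x \<in> Orb Q (\<triangleright>)"
  by (auto simp: Orb_def orbits_def orbit_of_def)

text \<open>Two moves along orbits: first x to x' with y fixed, then y to y' with x' fixed.\<close>

lemma B3_orbit_invariant:
  assumes Q: "x \<in> Q" "y \<in> Q" "x' \<in> Q" "y' \<in> Q"
    and orb: "orbit_of x = orbit_of x'" "orbit_of y = orbit_of y'"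
  shows "frag_of [x, y, y] - frag_of [x', y', y'] \<in> B3"
proof -
  \<comment> \<open>Chains differing by a boundary are boundaries together; the shape with
    \<open>P\<close> matches the invariance hypothesis of \<open>orbit_of_invariant\<close>.\<close>
  have step: "P c \<in> B3 \<longleftrightarrow> P d \<in> B3" if "P c - P d \<in> B3"
    for P :: "'a \<Rightarrow> 'a list \<Rightarrow>\<^sub>0 int" and c d
    using boundaries_add[OF that, of "P d"] boundaries_diff[OF _ that, of "P c"] by auto
  have left: "frag_of [u, z, z] - frag_of [u \<triangleright> b, z, z] \<in> B3"
    if "u \<in> Q" "b \<in> Q" "z \<in> Q" for u b z
  proof -
    have "[u, b, z, z] \<in> degenerate_tuples Q 4"
      using that by (auto simp: degenerate_tuples_4)
    from boundaries_generator[OF this, of "boundary_tuple (\<triangleright>)"] that show ?thesis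
      by (simp add: boundary_tuple_4 idem closed)
  qed
  have both: "frag_of [u, z, z] - frag_of [u \<triangleright> b, z \<triangleright> b, z \<triangleright> b] \<in> B3"
    if "u \<in> Q" "b \<in> Q" "z \<in> Q" for u b z
  proof -
    have "[u, z, z, b] \<in> degenerate_tuples Q 4"
      using that by (auto simp: degenerate_tuples_4)
    from boundaries_generator[OF this, of "boundary_tuple (\<triangleright>)"] that show ?thesis
      by (simp add: boundary_tuple_4 idem closed)
  qed
  \<comment> \<open>Acting on all entries and then undoing the action on the first moves only the
    doubled entry.\<close>
  have right: "frag_of [u, z, z] - frag_of [u, z \<triangleright> b, z \<triangleright> b] \<in> B3"
    if "u \<in> Q" "b \<in> Q" "z \<in> Q" for u b z
    using boundaries_diff[OF both[OF that] left[of u b "z \<triangleright> b"]] that closed by simp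
  \<comment> \<open>The right-hand chain is zero, hence a boundary, so the equivalence delivers the
    left-hand membership.\<close>
  have "frag_of [x, y, y] - frag_of [x', y, y] \<in> B3
      \<longleftrightarrow> frag_of [x', y, y] - frag_of [x', y, y] \<in> B3"
    by (rule orbit_of_invariant[OF Q(1,3) orb(1)])
      (use left Q in \<open>auto intro!:
          step[symmetric, where P = "\<lambda>u. frag_of [u, y, y] - frag_of [x', y, y]"]\<close>)
  moreover have "frag_of [x', y, y] - frag_of [x', y', y'] \<in> B3
      \<longleftrightarrow> frag_of [x', y', y'] - frag_of [x', y', y'] \<in> B3"
    by (rule orbit_of_invariant[OF Q(2,4) orb(2)])
      (use right Q in \<open>auto intro!:
          step[symmetric, where P = "\<lambda>u. frag_of [x', u, u] - frag_of [x', y', y']"]\<close>)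
  ultimately show ?thesis
    using boundaries_add[of "frag_of [x, y, y] - frag_of [x', y, y]"] zero_in_boundaries
    by fastforce
qed

text \<open>Doubling moves every later entry up one place, which flips its sign; the new difference
  for i = 2 vanishes by \<open>idem\<close>.\<close>

lemma boundary_stutter:
  assumes "Poly_Mapping.keys c \<subseteq> tuples Q 2"
  shows "frag_extend (boundary_tuple (\<triangleright>)) (stutter c)
    = - stutter (frag_extend (boundary_tuple (\<triangleright>)) c)"
  using assms
proof (induction c rule: free_Abelian_group_induct[consumes 1])
  case (3 a)
  then show ?case
    by (auto simp: tuples_2 stutter_def boundary_tuple_2 boundary_tuple_3 frag_extend_diff idem)
qed (auto simp: stutter_def frag_extend_diff)

lemma stutter_boundary:
  assumes "a \<in> tuples Q 3"
  shows "stutter (boundary_tuple (\<triangleright>) a) = - boundary_tuple (\<triangleright>) (hd a # a)"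
  using assms
  by (auto simp: tuples_3 stutter_def boundary_tuple_4 boundary_tuple_3 frag_extend_diff idem)

lemma retract_stutter: "Poly_Mapping.keys c \<subseteq> tuples Q 2 \<Longrightarrow> retract (stutter c) = c"
  by (induction c rule: free_Abelian_group_induct[consumes 1])
    (auto simp: tuples_2 stutter_def retract_def frag_extend_diff)

lemma stutter_in_Z3:
  assumes "c \<in> Z2" shows "stutter c \<in> Z3"
proof -
  have "Poly_Mapping.keys c \<subseteq> tuples Q 2" using assms by (simp add: cycles_def)
  then have "Poly_Mapping.keys (stutter c) \<subseteq> degenerate_tuples Q 3"
  proof (induction c rule: free_Abelian_group_induct[consumes 1])
    case (2 x y)
    then show ?case
      by (auto simp: stutter_def frag_extend_diff dest!: subsetD[OF keys_diff])
  qed (auto simp: stutter_def tuples_2 degenerate_tuples_3)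
  moreover have "frag_extend (boundary_tuple (\<triangleright>)) (stutter c) = 0"
    using assms boundary_stutter[of c] by (simp add: cycles_def stutter_def)
  ultimately show ?thesis by (simp add: cycles_def)
qed

lemma stutter_in_B3: "c \<in> B2 \<Longrightarrow> stutter c \<in> B3"
proof (induction rule: boundaries_induct)
  case zero
  then show ?case by (simp add: stutter_def zero_in_boundaries)
next
  case (diff x y)
  then show ?case by (simp add: stutter_def frag_extend_diff boundaries_diff)
next
  case (gen a)
  then have "hd a # a \<in> degenerate_tuples Q 4"
    by (auto simp: tuples_3 degenerate_tuples_4)
  then show ?case
    using gen by (simp add: stutter_boundary boundaries_minus boundaries_generator)
qed

text \<open>The boundary of [x, x, y, z] goes to minus the boundary of [x, y, z], that of
  [x, y, y, z] to minus the boundary of [y, y, z] or to 0 according to the orbit test, and that of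
  [x, y, z, z] to 0.\<close>

lemma retract_in_B2: "c \<in> B3 \<Longrightarrow> retract c \<in> B2"
proof (induction rule: boundaries_induct)
  case zero
  then show ?case by (simp add: retract_def zero_in_boundaries)
next
  case (diff x y)
  then show ?case by (simp add: retract_def frag_extend_diff boundaries_diff)
next
  case (gen a)
  then obtain x y z where a: "a = [x, x, y, z] \<or> a = [x, y, y, z] \<or> a = [x, y, z, z]"
    and Q: "x \<in> Q" "y \<in> Q" "z \<in> Q"
    by (auto simp: degenerate_tuples_4)
  have "- boundary_tuple (\<triangleright>) u \<in> B2" if "u \<in> tuples Q 3" for u
    using that by (intro boundaries_minus boundaries_generator)
  from this[of "[x, y, z]"] this[of "[y, y, z]"] show ?case
    using a Q closed zero_in_boundaries[of "tuples Q 3" "boundary_tuple (\<triangleright>)"]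
    by (auto simp: tuples_3 retract_def boundary_tuple_4 boundary_tuple_3 frag_extend_diff
        frag_extend_add idem algebra_simps)
qed

text \<open>After cancellation by \<open>idem\<close>, each remaining difference compares a triple
  with its image under a move along orbits, and both have the same class.\<close>

lemma orbit_class_B3: "c \<in> B3 \<Longrightarrow> orbit_class c = 0"
proof (induction rule: boundaries_induct)
  case (gen a)
  then show ?case using closed
    by (auto simp: degenerate_tuples_4 orbit_class_def boundary_tuple_4 frag_extend_diff
        frag_extend_add idem)
qed (auto simp: orbit_class_def frag_extend_diff)

lemma orbit_class_stutter: "Poly_Mapping.keys c \<subseteq> tuples Q 2 \<Longrightarrow> orbit_class (stutter c) = 0"
  by (induction c rule: free_Abelian_group_induct[consumes 1])
    (auto simp: tuples_2 stutter_def orbit_class_def frag_extend_diff)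

section \<open>Splitting degenerate 3-chains modulo boundaries\<close>

lemma keys_retract:
  assumes "Poly_Mapping.keys c \<subseteq> degenerate_tuples Q 3"
  shows "Poly_Mapping.keys (retract c) \<subseteq> tuples Q 2"
  using assms
proof (induction c rule: free_Abelian_group_induct[consumes 1])
  case (2 x y)
  then show ?case
    by (auto simp: retract_def frag_extend_diff dest!: subsetD[OF keys_diff])
qed (auto simp: retract_def tuples_2 degenerate_tuples_3)

lemma keys_orbit_class:
  assumes "Poly_Mapping.keys c \<subseteq> degenerate_tuples Q 3"
  shows "Poly_Mapping.keys (orbit_class c) \<subseteq> orbit_pairs"
  using assms
proof (induction c rule: free_Abelian_group_induct[consumes 1])
  case (2 x y)
  then show ?case
    by (auto simp: orbit_class_def frag_extend_diff dest!: subsetD[OF keys_diff])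
qed (auto simp: orbit_pairs_def orbit_class_def degenerate_tuples_3 orbit_of_in_Orb)

text \<open>Valid for all degenerate chains, cycles or not. On [x, x, y] the difference is 0; on
  [x, y, y] it compares the triple with [y, y, y] or with the chosen representatives of its
  orbits.\<close>

lemma degenerate_chain_decomposition:
  assumes "Poly_Mapping.keys c \<subseteq> degenerate_tuples Q 3"
  shows "c - stutter (retract c) - class_rep (orbit_class c) \<in> B3"
  using assms
proof (induction c rule: free_Abelian_group_induct[consumes 1])
  case 1
  then show ?case
    by (simp add: stutter_def retract_def class_rep_def orbit_class_def zero_in_boundaries)
next
  case (2 x y)
  from boundaries_diff[OF 2(3,4)] show ?case
    by (simp add: stutter_def retract_def class_rep_def orbit_class_def frag_extend_diff
        algebra_simps)
next
  case (3 a)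
  then obtain x y where a: "a = [x, x, y] \<or> a = [x, y, y]" and Q: "x \<in> Q" "y \<in> Q"
    by (auto simp: degenerate_tuples_3)
  have "frag_of [x, y, y] - frag_of [y, y, y] \<in> B3" if "orbit_of x = orbit_of y"
    by (rule B3_orbit_invariant) (use Q that in auto)
  moreover have "frag_of [x, y, y] - frag_of [orbit_rep (orbit_of x), orbit_rep (orbit_of y),
      orbit_rep (orbit_of y)] \<in> B3"
    by (rule B3_orbit_invariant) (use Q orbit_rep orbit_of_in_Orb in auto)
  ultimately show ?case
    using a by (auto simp: stutter_def retract_def class_rep_def orbit_class_def zero_in_boundaries)
qed

text \<open>Deleting the first entry undoes doubling for lists of every length. This is applied in
  degree 1, outside the range of \<open>retract_stutter\<close>.\<close>

lemma stutter_eq_0: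
  assumes "stutter c = 0" shows "c = 0"
proof -
  have "frag_extend (\<lambda>xs. frag_of (tl xs)) (stutter c) = c"
    using subset_UNIV
    by (induction c rule: free_Abelian_group_induct[consumes 1])
      (auto simp: stutter_def frag_extend_diff)
  then show ?thesis using assms by simp
qed

text \<open>That \<open>retract c\<close> is a cycle is obtained backwards: the difference is a
  boundary, hence a cycle, so \<open>stutter\<close> kills the boundary of \<open>retract c\<close>,
  and \<open>stutter\<close> is injective.\<close>

lemma decompose_null_class:
  assumes "c \<in> Z3" and "orbit_class c = 0"
  shows "retract c \<in> Z2" and "c - stutter (retract c) \<in> B3"
proof -
  have keys: "Poly_Mapping.keys c \<subseteq> degenerate_tuples Q 3"
    and c: "frag_extend (boundary_tuple (\<triangleright>)) c = 0"
    using assms by (auto simp: cycles_def)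
  show B3: "c - stutter (retract c) \<in> B3"
    using degenerate_chain_decomposition[OF keys] assms(2) by (simp add: class_rep_def)
  then have "frag_extend (boundary_tuple (\<triangleright>)) (c - stutter (retract c)) = 0"
    using B3_subset_Z3 by (auto simp: cycles_def)
  then have "stutter (frag_extend (boundary_tuple (\<triangleright>)) (retract c)) = 0"
    using c by (simp add: frag_extend_diff boundary_stutter keys_retract[OF keys])
  then show "retract c \<in> Z2"
    using keys_retract[OF keys] stutter_eq_0 by (auto simp: cycles_def)
qed

section \<open>The free quotient on ordered pairs of distinct orbits\<close>

lemma orbit_class_class_rep:
  "Poly_Mapping.keys u \<subseteq> orbit_pairs \<Longrightarrow> orbit_class (class_rep u) = u"
proof (induction u rule: free_Abelian_group_induct[consumes 1])
  case (3 a)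
  then obtain p q where "a = (p, q)" "p \<in> Orb Q (\<triangleright>)" "q \<in> Orb Q (\<triangleright>)" "p \<noteq> q"
    by (auto simp: orbit_pairs_def)
  then show ?case by (simp add: class_rep_def orbit_class_def orbit_rep)
qed (auto simp: class_rep_def orbit_class_def frag_extend_diff)

text \<open>In the boundary of [x, y, y] the differences for i = 2 and i = 3 cancel by
  \<open>idem\<close>.\<close>

lemma class_rep_in_Z3: "Poly_Mapping.keys u \<subseteq> orbit_pairs \<Longrightarrow> class_rep u \<in> Z3"
proof (induction u rule: free_Abelian_group_induct[consumes 1])
  case (2 x y)
  then show ?case
    by (auto simp: class_rep_def cycles_def frag_extend_diff dest: subsetD[OF keys_diff])
qed (auto simp: class_rep_def cycles_def orbit_pairs_def degenerate_tuples_3 boundary_tuple_3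
    orbit_rep idem)

lemma card_orbit_pairs:
  assumes "finite (Orb Q (\<triangleright>))"
  shows "finite orbit_pairs" and "card orbit_pairs = (card (Orb Q (\<triangleright>)))\<^sup>2 - card (Orb Q (\<triangleright>))"
proof -
  have pairs: "orbit_pairs = Orb Q (\<triangleright>) \<times> Orb Q (\<triangleright>) - (\<lambda>p. (p, p)) ` Orb Q (\<triangleright>)"
    by (auto simp: orbit_pairs_def)
  then show "finite orbit_pairs" using assms by simp
  have "card ((\<lambda>p. (p, p)) ` Orb Q (\<triangleright>)) = card (Orb Q (\<triangleright>))"
    by (rule card_image) (simp add: inj_on_def)
  moreover have "(\<lambda>p. (p, p)) ` Orb Q (\<triangleright>) \<subseteq> Orb Q (\<triangleright>) \<times> Orb Q (\<triangleright>)"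
    by auto
  ultimately show "card orbit_pairs = (card (Orb Q (\<triangleright>)))\<^sup>2 - card (Orb Q (\<triangleright>))"
    unfolding pairs using assms
    by (simp add: card_Diff_subset card_cartesian_product power2_eq_square)
qed

lemma short_exact_rack_degenerate:
  assumes h: "bij_betw h {..<k} orbit_pairs"
  shows "\<exists>f g. short_exact (rack_homology Q (\<triangleright>) 2) (degenerate_homology Q (\<triangleright>) 3) (Z_power k) f g"
proof -
  \<comment> \<open>The numbering \<open>h\<close> turns coefficients on orbit pairs into a vector;
    the restricted lambda makes it extensional, as elements of \<open>Z_power k\<close> must
    be.\<close>
  define coords where
    "coords c = (\<lambda>i\<in>{..<k}. Poly_Mapping.lookup (orbit_class c) (h i))" for c
  \<comment> \<open>The support of \<open>orbit_class c\<close> lies in \<open>orbit_pairs\<close>,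
    which \<open>h\<close> exhausts, so no coefficient escapes the coordinates.\<close>
  have coords_eq: "coords c = \<one>\<^bsub>Z_power k\<^esub> \<longleftrightarrow> orbit_class c = 0"
    if "Poly_Mapping.keys c \<subseteq> degenerate_tuples Q 3" for c
  proof
    assume "coords c = \<one>\<^bsub>Z_power k\<^esub>"
    then have "Poly_Mapping.lookup (orbit_class c) (h i) = 0" if "i < k" for i
      using that by (auto simp: coords_def Z_power_def dest!: fun_cong[of _ _ i])
    then have "Poly_Mapping.lookup (orbit_class c) pq = 0" if "pq \<in> orbit_pairs" for pq
      using that h by (metis bij_betw_def imageE lessThan_iff)
    moreover note keys_orbit_class[OF that]
    ultimately show "orbit_class c = 0"
      by (metis in_keys_iff keys_eq_empty subset_empty subsetI subsetD)
  qed (auto simp: coords_def Z_power_def)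
  have "\<exists>f g. short_exact (homology_of (rack_chain Q) (frag_extend (boundary_tuple (\<triangleright>))) 2)
      (homology_of (degenerate_chain Q) (frag_extend (boundary_tuple (\<triangleright>))) 3) (Z_power k) f g"
  proof (rule short_exact_homology[where S = "tuples Q" and T = "degenerate_tuples Q"
        and f = stutter and g = coords])
    show "rack_chain Q n = free_Abelian_group (tuples Q n)" for n
      by (simp add: rack_chain_def)
    show "degenerate_chain Q n = free_Abelian_group (degenerate_tuples Q n)" for n
      unfolding degenerate_chain_def rack_chain_def
      by (rule subgroup_generated_frag_of) (auto simp: degenerate_tuples_def)
    show "group (Z_power k)" by (simp add: Z_power_def)
    show "stutter (x + y) = stutter x + stutter y" for x y
      by (simp add: stutter_def frag_extend_add)
    show "coords (x + y) = coords x \<otimes>\<^bsub>Z_power k\<^esub> coords y" for x y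
      by (auto simp: coords_def Z_power_def orbit_class_def frag_extend_add lookup_add)
    show "coords ` Z3 = carrier (Z_power k)"
    proof (intro equalityI subsetI)
      show "v \<in> carrier (Z_power k)" if "v \<in> coords ` Z3" for v
        using that by (auto simp: coords_def Z_power_def split: if_splits)
    next
      fix v assume v: "v \<in> carrier (Z_power k)"
      \<comment> \<open>The chain with coordinate vector \<open>v\<close>; its image under
        \<open>class_rep\<close> is the cycle mapped to \<open>v\<close>.\<close>
      define u where "u = (\<Sum>i<k. frag_cmul (v i) (frag_of (h i)))"
      have keys: "Poly_Mapping.keys u \<subseteq> orbit_pairs"
        unfolding u_def using h
        by (intro order_trans[OF keys_sum]) (auto simp: bij_betw_def dest!: subsetD[OF keys_cmul])
      have "Poly_Mapping.lookup u (h i) = v i" if "i < k" for i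
      proof -
        have "Poly_Mapping.lookup u (h i) = (\<Sum>j<k. if j = i then v j else 0)"
          unfolding u_def lookup_sum
          using h that by (intro sum.cong) (auto simp: lookup_frag_of bij_betw_def inj_on_def)
        then show ?thesis using that by simp
      qed
      then have "coords (class_rep u) = v"
        using v keys by (auto simp: coords_def orbit_class_class_rep Z_power_def PiE_def
            extensional_def)
      then show "v \<in> coords ` Z3"
        using class_rep_in_Z3[OF keys] by blast
    qed
    show "\<exists>a\<in>Z2. c - stutter a \<in> boundaries (degenerate_tuples Q (3 + 1)) (boundary_tuple (\<triangleright>))"
      if "c \<in> Z3" "coords c = \<one>\<^bsub>Z_power k\<^esub>" for c
      using decompose_null_class[of c] that coords_eq by (auto simp: cycles_def)
    \<comment> \<open>Split injectivity: if \<open>stutter c\<close> bounds, then so does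
      \<open>retract (stutter c)\<close>, which is \<open>c\<close>.\<close>
    show "stutter c \<in> boundaries (degenerate_tuples Q (3 + 1)) (boundary_tuple (\<triangleright>))
        \<longleftrightarrow> c \<in> boundaries (tuples Q (2 + 1)) (boundary_tuple (\<triangleright>))" if "c \<in> Z2" for c
      using stutter_in_B3[of c] retract_in_B2[of "stutter c"] retract_stutter[of c] that
      by (auto simp: cycles_def)
    show "coords c = \<one>\<^bsub>Z_power k\<^esub>"
      if "c \<in> boundaries (degenerate_tuples Q (3 + 1)) (boundary_tuple (\<triangleright>))" for c
      using that orbit_class_B3[of c] by (auto simp: coords_def Z_power_def)
    show "coords (stutter c) = \<one>\<^bsub>Z_power k\<^esub>" if "c \<in> Z2" for c
      using that orbit_class_stutter[of c] by (auto simp: coords_def Z_power_def cycles_def)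
  qed (use B2_subset_Z2 B3_subset_Z3 stutter_in_Z3 in simp_all)
  then show ?thesis
    by (simp add: rack_homology_def degenerate_homology_def boundary_def)
qed

end

theorem proposition6p5:
  fixes Q :: "'a set" and opr :: "'a \<Rightarrow> 'a \<Rightarrow> 'a" and m :: nat
  assumes "quandle Q opr"
    and "finite (Orb Q opr)"
    and "m = card (Orb Q opr)"
  shows "\<exists>f g. short_exact (rack_homology Q opr 2) (degenerate_homology Q opr 3)
                 (Z_power (m ^ 2 - m)) f g"
proof -
  interpret quandle Q opr by fact
  \<comment> \<open>Finitely many orbits give finitely many pairs, and any enumeration of them
    serves as a basis.\<close>
  obtain h where "bij_betw h {..<card orbit_pairs} orbit_pairs"
    using ex_bij_betw_nat_finite[OF card_orbit_pairs(1)[OF assms(2)]]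
    by (auto simp: atLeast0LessThan)
  from short_exact_rack_degenerate[OF this] show ?thesis
    using card_orbit_pairs(2)[OF assms(2)] assms(3) by simp
qed

end
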